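(* Let $X\in\mathbb R^{n\times p}$ be a deterministic matrix of rank $r$ with nonzero singular values $s_1\ge\cdots\ge s_r>0$. Consider the Gaussian regression model $Y\mid\beta\sim N(X\beta,\sigma^2I_n)$, $\beta\sim N(0,\tau^2I_p)$ with $\sigma,\tau>0$, and write $\lambda=\tau^2/\sigma^2$. Let \[ \mathcal I(\lambda)=I_\lambda(\beta;Y)=\frac12\sum_{j=1}^r\log(1+\lambda s_j^2) \] denote the mutual information between $\beta$ and $Y$ as a function of $\lambda$, and let \[ \operatorname{df}(\alpha)=\operatorname{tr}\{X(X^\top X+\alpha I_p)^{-1}X^\top\}=\sum_{j=1}^r\frac{s_j^2}{s_j^2+\alpha},\qquad \alpha>0, \] denote the ridge degrees of freedom. Then for every $\lambda>0$, \[ 2\lambda\,\mathcal I'(\lambda)=\operatorname{df}(1/\lambda), \] and consequently \[ 2\mathcal I(\lambda)=\int_0^\lambda\frac{\operatorname{df}(1/t)}{t}\,dt . \]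
   Context: $I(U;V)=\mathrm{KL}(P_{U,V}\,\|\,P_U\otimes P_V)$ is mutual information (natural logarithm). The prior-to-noise ratio is $\lambda=\tau^2/\sigma^2$; the posterior mean of $\beta$ is the ridge estimator with penalty $\alpha=1/\lambda$. *)

theory Defs
  imports "HOL-Probability.Probability"
begin

text \<open>
  The singular values of \<open>X\<close> are the square roots of the eigenvalues of the symmetric matrix
  \<open>X\<^sup>T X\<close>, with multiplicity. The condition on \<open>c\<close> says that each \<open>c > 0\<close> occurs in
  \<open>s 1, \<dots>, s r\<close> exactly as often as the dimension of the eigenspace of \<open>X\<^sup>T X\<close> for \<open>c\<^sup>2\<close>
  (zero if \<open>c\<^sup>2\<close> is not an eigenvalue). Values of \<open>s\<close> outside \<open>{1..r}\<close> are irrelevant.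
\<close>

definition nonzero_singular_values :: "real^'p^'n \<Rightarrow> nat \<Rightarrow> (nat \<Rightarrow> real) \<Rightarrow> bool" where
  "nonzero_singular_values X r s \<longleftrightarrow>
     (\<forall>j\<in>{1..r}. 0 < s j) \<and>
     antimono_on {1..r} s \<and>
     (\<forall>c>0. card {j \<in> {1..r}. s j = c} =
        dim {v :: real^'p. (transpose X ** X) *v v = c\<^sup>2 *\<^sub>R v})"

text \<open>The second parameter is the standard deviation of each coordinate, as in
  \<^const>\<open>normal_density\<close>; the law is \<open>N(m, \<sigma>\<^sup>2 I)\<close>.\<close>

definition isotropic_normal :: "real^'k \<Rightarrow> real \<Rightarrow> (real^'k) measure" where
  "isotropic_normal m \<sigma> =
     density lborel (\<lambda>x. ennreal (\<Prod>i\<in>UNIV. normal_density (m $ i) \<sigma> (x $ i)))"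

text \<open>The last assumption says that \<open>b \<mapsto> N(X b, \<sigma>\<^sup>2 I)\<close> is a regular conditional
  distribution of \<open>Y\<close> given \<open>\<beta>\<close>.\<close>

locale gaussian_regression = prob_space M
  for M :: "'a measure" and X :: "real^'p^'n" and \<sigma> \<tau> :: real
    and \<beta> :: "'a \<Rightarrow> real^'p" and Y :: "'a \<Rightarrow> real^'n" +
  assumes sd_pos: "0 < \<sigma>" "0 < \<tau>"
    and measurable_param: "\<beta> \<in> borel_measurable M"
    and measurable_response: "Y \<in> borel_measurable M"
    and prior: "distr M borel \<beta> = isotropic_normal 0 \<tau>"
    and likelihood: "\<And>A B. A \<in> sets borel \<Longrightarrow> B \<in> sets borel \<Longrightarrow>
      emeasure M {\<omega> \<in> space M. \<beta> \<omega> \<in> A \<and> Y \<omega> \<in> B} =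
        (\<integral>\<^sup>+b\<in>A. emeasure (isotropic_normal (X *v b) \<sigma>) B \<partial>distr M borel \<beta>)"

definition ridge_df :: "real^'p^'n \<Rightarrow> real \<Rightarrow> real" where
  "ridge_df X \<alpha> =
     trace (X ** matrix_inv (transpose X ** X + \<alpha> *\<^sub>R mat 1) ** transpose X)"

end

theory Submission
  imports Defs
begin

text \<open>
  Diagonalize \<open>X\<^sup>T X\<close> in an orthonormal basis with eigenvalues \<open>\<mu>\<^sub>i\<close>. Completing the square around the
  ridge estimator writes the joint density of \<open>(\<beta>, Y)\<close> as the posterior density, a Gaussian with
  precisions \<open>\<mu>\<^sub>i / \<sigma>\<^sup>2 + 1 / \<tau>\<^sup>2\<close> in that basis, times the density of \<open>Y\<close>. The mutual information is
  the expected log ratio of posterior to prior; the two quadratic forms in its exponent both have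
  expectation \<open>p\<close> and cancel, and the normalizing constants give
  \<open>1/2 \<Sum>\<^sub>i ln (1 + (\<tau>\<^sup>2 / \<sigma>\<^sup>2) \<mu>\<^sub>i)\<close>. Zero eigenvalues contribute nothing to this sum or to the ridge
  degrees of freedom, so both reduce to sums over the nonzero singular values. The rest is calculus.
\<close>

section \<open>The spectral theorem for symmetric real matrices\<close>

text \<open>First-order condition at a maximum. Taking \<open>t = a / k\<close> turns the expression
  into \<open>(a / k)\<^sup>2 * (2 * k + b)\<close>, and \<open>k = \<bar>b\<bar> + 1\<close> makes
  the second factor positive.\<close>

lemma linear_coefficient_zero_of_nonpos:
  fixes a b :: real
  assumes "\<And>t. 2 * t * a + t\<^sup>2 * b \<le> 0"
  shows "a = 0"
proof (rule ccontr)
  assume "a \<noteq> 0"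
  define k where "k = \<bar>b\<bar> + 1"
  have k: "k > 0" "2 * k + b > 0" by (auto simp: k_def)
  have "2 * (a / k) * a + (a / k)\<^sup>2 * b = (a / k)\<^sup>2 * (2 * k + b)"
    using k by (simp add: field_simps power2_eq_square)
  moreover have "(a / k)\<^sup>2 * (2 * k + b) > 0"
    using k \<open>a \<noteq> 0\<close> by simp
  ultimately show False using assms[of "a / k"] by simp
qed

text \<open>A maximizer of the Rayleigh quotient on the unit sphere is an eigenvector.\<close>

lemma selfadjoint_eigenvector_exists:
  fixes f :: "'a::euclidean_space \<Rightarrow> 'a"
  assumes lin: "linear f" and adj: "\<And>x y. f x \<bullet> y = x \<bullet> f y"
    and S: "subspace S" "f ` S \<subseteq> S" "S \<noteq> {0}"
  shows "\<exists>v \<mu>. v \<in> S \<and> norm v = 1 \<and> f v = \<mu> *\<^sub>R v"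
proof -
  let ?K = "S \<inter> sphere 0 1"
  have "compact ?K"
    using closed_subspace[OF S(1)] compact_sphere by (metis closed_Int_compact)
  moreover have "?K \<noteq> {}"
  proof -
    obtain x where "x \<in> S" "x \<noteq> 0" using S subspace_0 by fastforce
    then have "x /\<^sub>R norm x \<in> ?K" using S(1) by (simp add: subspace_scale)
    then show ?thesis by blast
  qed
  moreover have "continuous_on ?K (\<lambda>x. x \<bullet> f x)"
    by (intro continuous_intros linear_continuous_on linear_conv_bounded_linear[THEN iffD1] lin)
  ultimately obtain v where v: "v \<in> ?K" and max: "\<And>x. x \<in> ?K \<Longrightarrow> x \<bullet> f x \<le> v \<bullet> f v"
    by (meson continuous_attains_sup)
  define m where "m = v \<bullet> f v"
  have vv: "v \<bullet> v = 1" using v by (simp add: norm_eq_1)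
  have vS: "v \<in> S" using v by simp
  \<comment> \<open>Both sides are homogeneous of degree two, so the maximum over the unit sphere
    bounds the form on all of \<open>S\<close>.\<close>
  have bound: "x \<bullet> f x \<le> m * (x \<bullet> x)" if "x \<in> S" for x
  proof (cases "x = 0")
    case False
    have "x /\<^sub>R norm x \<in> ?K" using S(1) that False by (simp add: subspace_scale)
    from max[OF this] have "(x \<bullet> f x) / (norm x)\<^sup>2 \<le> m"
      using False by (simp add: m_def linear_scale[OF lin] power2_eq_square divide_inverse mult_ac)
    then show ?thesis using False by (simp add: divide_le_eq power2_norm_eq_inner)
  qed (simp add: linear_0[OF lin])
  \<comment> \<open>At \<open>v + t *\<^sub>R w\<close> the terms of order zero in \<open>t\<close>
    cancel because \<open>m\<close> is attained at \<open>v\<close>. What remains is a nonpositive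
    quadratic in \<open>t\<close>, whose linear coefficient must vanish.\<close>
  have orth: "w \<bullet> (f v - m *\<^sub>R v) = 0" if w: "w \<in> S" for w
  proof (rule linear_coefficient_zero_of_nonpos)
    fix t :: real
    have "v + t *\<^sub>R w \<in> S" using S(1) vS w by (simp add: subspace_add subspace_scale)
    from bound[OF this]
    show "2 * t * (w \<bullet> (f v - m *\<^sub>R v)) + t\<^sup>2 * (w \<bullet> f w - m * (w \<bullet> w)) \<le> 0"
      using adj[of v w] vv m_def
      by (simp add: linear_add[OF lin] linear_scale[OF lin] inner_simps inner_commute[of "f v"]
          inner_commute[of v w] power2_eq_square algebra_simps)
  qed
  \<comment> \<open>The residual lies in \<open>S\<close> and is orthogonal to \<open>S\<close>,
    hence to itself.\<close>
  have "f v - m *\<^sub>R v \<in> S"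
    using S vS by (auto intro!: subspace_diff subspace_scale)
  from orth[OF this] have "f v = m *\<^sub>R v" by simp
  with v show ?thesis by auto
qed

text \<open>Induction on dimension: split off a unit eigenvector \<open>v\<close>; self-adjointness
  keeps its orthogonal complement inside \<open>S\<close> invariant. The claim ranges over invariant
  subspaces so that it applies to this complement.\<close>

lemma selfadjoint_orthonormal_eigenbasis:
  fixes f :: "'a::euclidean_space \<Rightarrow> 'a"
  assumes lin: "linear f" and adj: "\<And>x y. f x \<bullet> y = x \<bullet> f y"
    and S: "subspace S" "f ` S \<subseteq> S"
  shows "\<exists>B. B \<subseteq> S \<and> pairwise orthogonal B \<and> (\<forall>x\<in>B. norm x = 1 \<and> (\<exists>\<mu>. f x = \<mu> *\<^sub>R x)) \<and>
    span B = S"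
  using S
proof (induction "dim S" arbitrary: S rule: less_induct)
  case less
  show ?case
  proof (cases "S = {0}")
    case True
    then show ?thesis by (intro exI[of _ "{}"]) auto
  next
    case False
    then obtain v \<mu> where v: "v \<in> S" "norm v = 1" "f v = \<mu> *\<^sub>R v"
      using selfadjoint_eigenvector_exists[OF lin adj less.prems] by blast
    let ?T = "S \<inter> {x. v \<bullet> x = 0}"
    have T: "subspace ?T" by (intro subspace_inter less.prems subspace_hyperplane)
    have fT: "f ` ?T \<subseteq> ?T"
      using less.prems(2) v adj[of v, symmetric] by (auto simp: image_subset_iff)
    have "v \<notin> ?T" using v by auto
    then have "?T \<subset> S" using v by blast
    then have "dim ?T < dim S"
      by (intro dim_psubset) (use T less.prems(1) in \<open>simp add: span_eq_iff[THEN iffD2]\<close>)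
    from less.hyps[OF this T fT] obtain B where B: "B \<subseteq> ?T" "pairwise orthogonal B"
      "\<forall>x\<in>B. norm x = 1 \<and> (\<exists>\<mu>. f x = \<mu> *\<^sub>R x)" "span B = ?T" by blast
    have "span (insert v B) = S"
    proof
      show "span (insert v B) \<subseteq> S" using B v less.prems(1) by (intro span_minimal) auto
      show "S \<subseteq> span (insert v B)"
      proof
        fix x assume "x \<in> S"
        then have "x - (v \<bullet> x) *\<^sub>R v \<in> ?T"
          using v less.prems(1) by (auto simp: subspace_diff subspace_scale inner_simps norm_eq_1)
        then have "x - (v \<bullet> x) *\<^sub>R v \<in> span B" using B by simp
        then show "x \<in> span (insert v B)" by (rule span_breakdown_eq[THEN iffD2, OF exI])
      qed
    qed
    moreover have "pairwise orthogonal (insert v B)"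
      using B by (auto simp: pairwise_insert orthogonal_def inner_commute)
    ultimately show ?thesis using B v by (intro exI[of _ "insert v B"]) auto
  qed
qed

section \<open>Diagonal matrices and orthogonal diagonalization\<close>

definition diagonal_matrix :: "('k \<Rightarrow> real) \<Rightarrow> real^'k^'k" where
  "diagonal_matrix d = (\<chi> i j. if i = j then d i else 0)"

lemma diagonal_matrix_vector_mul [simp]:
  "(diagonal_matrix d *v x) $ i = d i * x $ (i :: 'k::finite)"
  by (simp add: diagonal_matrix_def matrix_vector_mult_def if_distrib [of "\<lambda>c. c * _"] cong: if_cong)

lemma diagonal_matrix_mul:
  "diagonal_matrix c ** diagonal_matrix d = diagonal_matrix (\<lambda>i::'k::finite. c i * d i)"
  by (simp add: matrix_eq vec_eq_iff matrix_vector_mul_assoc[symmetric])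

lemma trace_diagonal_matrix: "trace (diagonal_matrix d) = (\<Sum>i::'k::finite\<in>UNIV. d i)"
  by (simp add: trace_def diagonal_matrix_def)

text \<open>An orthonormal eigenbasis has \<open>CARD('k)\<close> elements, so it can be indexed by
  \<open>'k\<close> itself; its members become the rows of \<open>V\<close>.\<close>

theorem symmetric_matrix_diagonalization:
  fixes A :: "real^'k^'k"
  assumes "transpose A = A"
  obtains V \<mu> where "orthogonal_matrix V" "A = transpose V ** diagonal_matrix \<mu> ** V"
proof -
  have "\<exists>B. B \<subseteq> UNIV \<and> pairwise orthogonal B \<and>
     (\<forall>x\<in>B. norm x = 1 \<and> (\<exists>\<mu>. A *v x = \<mu> *\<^sub>R x)) \<and> span B = UNIV"
  proof (rule selfadjoint_orthonormal_eigenbasis)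
    show "(A *v x) \<bullet> y = x \<bullet> (A *v y)" for x y
      by (metis assms dot_lmul_matrix vector_transpose_matrix)
  qed auto
  then obtain B where B: "pairwise orthogonal B" "\<And>x. x \<in> B \<Longrightarrow> norm x = 1"
    "\<And>x. x \<in> B \<Longrightarrow> \<exists>\<mu>. A *v x = \<mu> *\<^sub>R x" "span B = UNIV" by blast
  have "0 \<notin> B" using B(2) by fastforce
  with B(1) have ind: "independent B" by (rule pairwise_orthogonal_independent)
  have "card B = CARD('k)"
    using basis_card_eq_dim[OF _ _ ind, of UNIV] B(4) by simp
  then obtain e where e: "bij_betw e (UNIV :: 'k set) B"
    using independent_imp_finite[OF ind] by (metis finite_same_card_bij finite)
  have eB: "e i \<in> B" for i using e by (auto simp: bij_betw_def)
  then have "\<forall>i. \<exists>c. A *v e i = c *\<^sub>R e i" using B(3) by blast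
  then obtain \<mu> where \<mu>: "\<And>i. A *v e i = \<mu> i *\<^sub>R e i" by metis
  define V where "V = (\<chi> i. e i)"
  have row: "row i V = e i" for i by (simp add: V_def row_def vec_eq_iff)
  have "orthogonal (e i) (e j)" if "i \<noteq> j" for i j
    using that pairwiseD[OF B(1) eB eB] inj_onD[OF bij_betw_imp_inj_on[OF e]] by blast
  then have V: "orthogonal_matrix V"
    unfolding orthogonal_matrix_orthonormal_rows row using eB B(2) by simp
  have "A ** transpose V = transpose V ** diagonal_matrix \<mu>"
  proof -
    have "(A ** transpose V) $ k $ i = (A *v e i) $ k" for k i
      by (simp add: matrix_matrix_mult_def matrix_vector_mult_def transpose_def V_def)
    then show ?thesis
      by (simp add: \<mu> vec_eq_iff) (simp add: matrix_matrix_mult_def transpose_def V_def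
         diagonal_matrix_def if_distrib cong: if_cong)
  qed
  then have "A ** transpose V ** V = transpose V ** diagonal_matrix \<mu> ** V" by simp
  then have "A = transpose V ** diagonal_matrix \<mu> ** V"
    using V by (simp add: orthogonal_matrix_def flip: matrix_mul_assoc)
  with V that show thesis by blast
qed

(* This default simp rule would rewrite the left-hand sides of orthogonal_matrix_cancel. *)
declare transpose_matrix_vector [simp del]

section \<open>Eigenspaces, resolvents and traces read off from a diagonalization\<close>

context
  fixes A V :: "real^'k^'k" and \<mu> :: "'k \<Rightarrow> real"
  assumes V: "orthogonal_matrix V" and A: "A = transpose V ** diagonal_matrix \<mu> ** V"
begin

lemma orthogonal_matrix_cancel [simp]:
  "V *v (transpose V *v x) = x" "transpose V *v (V *v x) = x"
  using V by (simp_all add: matrix_vector_mul_assoc orthogonal_matrix_def)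

lemma quadratic_form_diagonalized: "x \<bullet> (A *v x) = (\<Sum>i\<in>UNIV. \<mu> i * ((V *v x) $ i)\<^sup>2)"
proof -
  have "x \<bullet> (A *v x) = (V *v x) \<bullet> (diagonal_matrix \<mu> *v (V *v x))"
    unfolding A by (simp only: matrix_vector_mul_assoc[symmetric])
      (metis dot_lmul_matrix transpose_transpose vector_transpose_matrix)
  then show ?thesis by (simp add: inner_vec_def power2_eq_square mult_ac)
qed

text \<open>The injective map \<open>V\<close> carries the eigenspace onto the vectors supported on
  the coordinates with \<open>\<mu> i = c\<close>. This ties the dimensions in
  \<open>nonzero_singular_values\<close> to multiplicities among the \<open>\<mu> i\<close>.\<close>

lemma dim_eigenspace_diagonalized: "dim {x. A *v x = c *\<^sub>R x} = card {i. \<mu> i = c}"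
proof -
  have "A *v x = c *\<^sub>R x \<longleftrightarrow> (\<forall>i. i \<notin> {i. \<mu> i = c} \<longrightarrow> (V *v x) $ i = 0)" for x
  proof -
    have "A *v x = c *\<^sub>R x \<longleftrightarrow> V *v (A *v x) = V *v (c *\<^sub>R x)"
      by (metis orthogonal_matrix_cancel(2))
    also have "\<dots> \<longleftrightarrow> diagonal_matrix \<mu> *v (V *v x) = c *\<^sub>R (V *v x)"
      by (simp only: A matrix_vector_mult_scaleR matrix_vector_mul_assoc[symmetric] orthogonal_matrix_cancel)
    finally show ?thesis by (auto simp: vec_eq_iff)
  qed
  then have "(*v) V ` {x. A *v x = c *\<^sub>R x} = {y. \<forall>i. i \<notin> {i. \<mu> i = c} \<longrightarrow> y $ i = 0}"
    by (auto simp: image_iff) (metis orthogonal_matrix_cancel(1))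
  moreover have "dim ((*v) V ` {x. A *v x = c *\<^sub>R x}) = dim {x. A *v x = c *\<^sub>R x}"
    by (intro dim_image_eq) (auto intro!: inj_on_inverseI[of _ "(*v) (transpose V)"])
  ultimately show ?thesis
    using dim_substandard_cart[of "{i. \<mu> i = c}", where 'a=real] by (simp add: dim_vec_eq)
qed

lemma diagonalized_mul:
  "(transpose V ** diagonal_matrix c ** V) ** (transpose V ** diagonal_matrix d ** V) =
    transpose V ** diagonal_matrix (\<lambda>i. c i * d i) ** V" (is "?L = ?R")
proof -
  have "?L *v x = ?R *v x" for x
    by (simp only: matrix_vector_mul_assoc[symmetric] orthogonal_matrix_cancel)
      (simp only: matrix_vector_mul_assoc diagonal_matrix_mul matrix_mul_assoc)
  then show ?thesis using matrix_eq by blast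
qed

text \<open>\<open>matrix_inv\<close> chooses some two-sided inverse. The explicit matrix
  \<open>?C\<close> shows that one exists, and multiplying by \<open>?C\<close> from the left
  identifies the chosen inverse with it.\<close>

lemma
  assumes nz: "\<And>i. \<mu> i + \<alpha> \<noteq> 0"
  shows resolvent_right_inverse:
      "(A + \<alpha> *\<^sub>R mat 1) ** matrix_inv (A + \<alpha> *\<^sub>R mat 1) = mat 1"
    and resolvent_diagonalized: "matrix_inv (A + \<alpha> *\<^sub>R mat 1) =
      transpose V ** diagonal_matrix (\<lambda>i. 1 / (\<mu> i + \<alpha>)) ** V"
proof -
  let ?conj = "\<lambda>d. transpose V ** diagonal_matrix d ** V"
  have shifted: "A + \<alpha> *\<^sub>R mat 1 = ?conj (\<lambda>i. \<mu> i + \<alpha>)"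
  proof -
    have "(A + \<alpha> *\<^sub>R mat 1) *v x = ?conj (\<lambda>i. \<mu> i + \<alpha>) *v x" for x
    proof -
      have "diagonal_matrix (\<lambda>i. \<mu> i + \<alpha>) *v (V *v x) = diagonal_matrix \<mu> *v (V *v x) + \<alpha> *\<^sub>R (V *v x)"
        by (simp add: vec_eq_iff algebra_simps)
      then have "?conj (\<lambda>i. \<mu> i + \<alpha>) *v x = A *v x + \<alpha> *\<^sub>R x"
        by (simp only: A matrix_vector_mul_assoc[symmetric] matrix_vector_right_distrib
            matrix_vector_mult_scaleR orthogonal_matrix_cancel)
      moreover have "(A + \<alpha> *\<^sub>R mat 1) *v x = A *v x + \<alpha> *\<^sub>R x"
        by (simp only: matrix_vector_mult_add_rdistrib scaleR_matrix_vector_assoc[symmetric]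
            matrix_vector_mul_lid)
      ultimately show ?thesis by simp
    qed
    then show ?thesis using matrix_eq by blast
  qed
  have "diagonal_matrix (\<lambda>_. 1) = (mat 1 :: real^'k^'k)"
    by (simp add: diagonal_matrix_def mat_def)
  then have one: "?conj (\<lambda>_. 1) = mat 1"
    using V by (simp add: orthogonal_matrix_def)
  let ?C = "?conj (\<lambda>i. 1 / (\<mu> i + \<alpha>))"
  have C: "?C ** (A + \<alpha> *\<^sub>R mat 1) = mat 1" "(A + \<alpha> *\<^sub>R mat 1) ** ?C = mat 1"
    unfolding shifted diagonalized_mul using nz one by simp_all
  then show right_inv: "(A + \<alpha> *\<^sub>R mat 1) ** matrix_inv (A + \<alpha> *\<^sub>R mat 1) = mat 1"
    (is "_ ** ?B = _")
    unfolding matrix_inv_def by (rule_tac someI2) blast+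
  then have "?C ** ((A + \<alpha> *\<^sub>R mat 1) ** ?B) = ?C" by simp
  then show "?B = ?C" by (simp only: matrix_mul_assoc C matrix_mul_lid)
qed

lemma trace_resolvent_diagonalized:
  assumes nz: "\<And>i. \<mu> i + \<alpha> \<noteq> 0"
  shows "trace (matrix_inv (A + \<alpha> *\<^sub>R mat 1) ** A) = (\<Sum>i\<in>UNIV. \<mu> i / (\<mu> i + \<alpha>))"
proof -
  let ?d = "diagonal_matrix (\<lambda>i. 1 / (\<mu> i + \<alpha>) * \<mu> i)"
  have "matrix_inv (A + \<alpha> *\<^sub>R mat 1) ** A = transpose V ** ?d ** V"
    using diagonalized_mul[of "\<lambda>i. 1 / (\<mu> i + \<alpha>)" \<mu>]
    by (simp only: resolvent_diagonalized[OF nz]) (simp only: A[symmetric])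
  also have "trace \<dots> = trace (V ** transpose V ** ?d)"
    by (subst matrix_mul_assoc[symmetric], subst trace_mul_sym) (simp only: matrix_mul_assoc)
  finally show ?thesis using V by (simp add: orthogonal_matrix_def trace_diagonal_matrix)
qed

end

section \<open>Gram matrices and singular values\<close>

lemma
  fixes X :: "real^'p^'n"
  assumes V: "orthogonal_matrix V"
    and A: "transpose X ** X = transpose V ** diagonal_matrix \<mu> ** V"
  shows norm_sq_diagonalized_gram: "norm (X *v b) ^ 2 = (\<Sum>i\<in>UNIV. \<mu> i * ((V *v b) $ i)\<^sup>2)"
    and gram_eigenvalue_nonneg: "\<mu> i \<ge> 0"
proof -
  show eq: "norm (X *v b) ^ 2 = (\<Sum>i\<in>UNIV. \<mu> i * ((V *v b) $ i)\<^sup>2)" for b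
    unfolding quadratic_form_diagonalized[OF V A, symmetric]
    by (simp add: power2_norm_eq_inner flip: matrix_vector_mul_assoc)
      (metis dot_lmul_matrix transpose_transpose vector_transpose_matrix)
  \<comment> \<open>Evaluating the form at the \<open>i\<close>-th eigenvector exhibits
    \<open>\<mu> i\<close> as a squared norm.\<close>
  have "norm (X *v (transpose V *v axis i 1)) ^ 2 = \<mu> i"
  proof -
    have "\<mu> j * ((axis i 1 :: real^'p) $ j)\<^sup>2 = (if j = i then \<mu> j else 0)" for j
      by (simp add: axis_def)
    then show ?thesis unfolding eq by (simp add: orthogonal_matrix_cancel[OF V])
  qed
  then show "\<mu> i \<ge> 0" by (metis zero_le_power2)
qed

text \<open>Each positive value occurs equally often among the squares of the \<open>s j\<close> and
  among the \<open>\<mu> i\<close>, since both counts are the dimension of its eigenspace. Grouping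
  both sums by value matches them, and \<open>F 0 = 0\<close> absorbs the zero eigenvalues.\<close>

lemma sum_nonzero_singular_values:
  fixes X :: "real^'p^'n" and F :: "real \<Rightarrow> real"
  assumes V: "orthogonal_matrix V"
    and A: "transpose X ** X = transpose V ** diagonal_matrix \<mu> ** V"
    and s: "nonzero_singular_values X r s" and F: "F 0 = 0"
  shows "(\<Sum>j=1..r. F ((s j)\<^sup>2)) = (\<Sum>i\<in>UNIV. F (\<mu> i))"
proof -
  have \<mu>: "\<mu> i \<ge> 0" for i by (rule gram_eigenvalue_nonneg[OF V A])
  have pos: "0 < s j" if "j \<in> {1..r}" for j
    using s that by (auto simp: nonzero_singular_values_def)
  have card_eq: "card {j \<in> {1..r}. (s j)\<^sup>2 = c} = card {i. \<mu> i = c}" if "c > 0" for c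
  proof -
    have "(s j)\<^sup>2 = c \<longleftrightarrow> s j = sqrt c" if "j \<in> {1..r}" for j
      using pos[OF that] \<open>c > 0\<close> by (metis abs_of_pos real_sqrt_abs real_sqrt_pow2 less_imp_le)
    then have "{j \<in> {1..r}. (s j)\<^sup>2 = c} = {j \<in> {1..r}. s j = sqrt c}" by blast
    moreover have "card {j \<in> {1..r}. s j = sqrt c} = dim {v. (transpose X ** X) *v v = (sqrt c)\<^sup>2 *\<^sub>R v}"
      using s that unfolding nonzero_singular_values_def by (meson real_sqrt_gt_zero)
    ultimately show ?thesis
      using that by (simp add: dim_eigenspace_diagonalized[OF V A])
  qed
  let ?J = "{1..r}" and ?I = "{i. \<mu> i \<noteq> 0}"
  \<comment> \<open>A common index set of values for both groupings; a value missing from one family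
    would only give an empty group there.\<close>
  define C where "C = (\<lambda>j. (s j)\<^sup>2) ` ?J \<union> \<mu> ` ?I"
  have C: "finite C" by (simp add: C_def)
  have Cpos: "c > 0" if "c \<in> C" for c
    using that unfolding C_def
  proof
    assume "c \<in> (\<lambda>j. (s j)\<^sup>2) ` ?J"
    then show "c > 0" using pos by force
  next
    assume "c \<in> \<mu> ` ?I"
    then show "c > 0" using \<mu> by (auto simp: less_le)
  qed
  have "(\<Sum>j\<in>?J. F ((s j)\<^sup>2)) = (\<Sum>c\<in>C. \<Sum>j\<in>{j \<in> ?J. (s j)\<^sup>2 = c}. F ((s j)\<^sup>2))"
    by (intro sum.group[symmetric] C) (auto simp: C_def)
  also have "\<dots> = (\<Sum>c\<in>C. \<Sum>i\<in>{i \<in> ?I. \<mu> i = c}. F (\<mu> i))"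
  proof (intro sum.cong refl)
    fix c assume "c \<in> C"
    then have c: "c > 0" by (rule Cpos)
    then have "{i \<in> ?I. \<mu> i = c} = {i. \<mu> i = c}" by auto
    then show "(\<Sum>j\<in>{j \<in> ?J. (s j)\<^sup>2 = c}. F ((s j)\<^sup>2)) = (\<Sum>i\<in>{i \<in> ?I. \<mu> i = c}. F (\<mu> i))"
      using card_eq[OF c] by simp
  qed
  also have "\<dots> = (\<Sum>i\<in>?I. F (\<mu> i))"
    by (intro sum.group C) (auto simp: C_def)
  also have "\<dots> = (\<Sum>i\<in>UNIV. F (\<mu> i))"
    by (intro sum.mono_neutral_left) (auto simp: F)
  finally show ?thesis .
qed

section \<open>Gaussian integrals\<close>

text \<open>
  The orthogonal invariance in HOL-Analysis requires a well-ordered index type. Here it follows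
  from the uniqueness of Haar measure: both measures are translation invariant, so by Fubini they
  are proportional, and they agree on the unit ball.
\<close>

lemma lborel_distr_orthogonal_transformation:
  fixes T :: "'a::euclidean_space \<Rightarrow> 'a"
  assumes T: "orthogonal_transformation T"
  shows "distr lborel borel T = lborel"
proof (rule measure_eqI)
  have lin: "linear T" using T by (simp add: orthogonal_transformation_linear)
  have bl: "bounded_linear T" using lin by (simp add: linear_conv_bounded_linear)
  have T_meas [measurable]: "T \<in> borel_measurable borel"
    by (intro borel_measurable_continuous_onI linear_continuous_on bl)
  have shift: "(\<integral>\<^sup>+x. f (c + x) \<partial>lborel) = (\<integral>\<^sup>+x. f x \<partial>lborel)"
    if [measurable]: "f \<in> borel_measurable borel" for f :: "'a \<Rightarrow> ennreal" and c
    by (subst lborel_distr_plus[symmetric, of c], subst nn_integral_distr) auto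
  fix B :: "'a set" assume "B \<in> sets (distr lborel borel T)"
  then have B [measurable]: "B \<in> sets borel" by simp
  \<comment> \<open>The unit ball is the reference set: it is invariant under \<open>T\<close> and
    under negation, and its volume \<open>vA\<close> is positive and finite, so it can be cancelled
    at the end.\<close>
  define A :: "'a set" where "A = ball 0 1"
  have A [measurable]: "A \<in> sets borel" by (simp add: A_def)
  define vA where "vA = emeasure lborel A"
  have vA: "vA \<noteq> 0" "vA < \<infinity>"
    using emeasure_lborel_ball_finite[of "0::'a" 1] content_ball_pos[of 1 "0::'a"]
    by (auto simp: vA_def A_def measure_def)
  have A_T: "indicator A (T x) = (indicator A x :: ennreal)" for x
    using T by (simp add: A_def indicator_def orthogonal_transformation_norm)
  have A_minus: "indicator A (x - y) = (indicator A (- x + y) :: ennreal)" for x y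
    by (simp add: A_def indicator_def norm_minus_commute)
  \<comment> \<open>Translate \<open>y\<close> by \<open>T x\<close>, swap the integrals, translate
    \<open>x\<close> for fixed \<open>y\<close>, and swap back; the ball then integrates out again,
    leaving the image measure of \<open>B\<close>.\<close>
  have "vA * emeasure lborel B = (\<integral>\<^sup>+x. indicator A (T x) * (\<integral>\<^sup>+y. indicator B y \<partial>lborel) \<partial>lborel)"
    by (simp add: nn_integral_multc vA_def A_T)
  also have "\<dots> = (\<integral>\<^sup>+x. indicator A (T x) * (\<integral>\<^sup>+y. indicator B (T x + y) \<partial>lborel) \<partial>lborel)"
    by (intro nn_integral_cong arg_cong2[where f="(*)"] refl shift[symmetric]) measurable
  also have "\<dots> = (\<integral>\<^sup>+x. (\<integral>\<^sup>+y. indicator A (T x) * indicator B (T x + y) \<partial>lborel) \<partial>lborel)"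
    by (simp add: nn_integral_cmult)
  also have "\<dots> = (\<integral>\<^sup>+y. (\<integral>\<^sup>+x. indicator A (T x) * indicator B (T x + y) \<partial>lborel) \<partial>lborel)"
    by (intro lborel_pair.Fubini') measurable
  also have "\<dots> = (\<integral>\<^sup>+y. (\<integral>\<^sup>+x. indicator A (T x - y) * indicator B (T x) \<partial>lborel) \<partial>lborel)"
  proof (rule nn_integral_cong)
    fix y
    \<comment> \<open>Translating by \<open>y\<close> after \<open>T\<close> is translating by
      \<open>c\<close> before it, which leaves Lebesgue measure unchanged.\<close>
    obtain c where c: "T c = y" using T by (metis orthogonal_transformation_surj surj_def)
    have "(\<integral>\<^sup>+x. indicator A (T x) * indicator B (T x + y) \<partial>lborel) =
        (\<integral>\<^sup>+x. indicator A (T (- c + x)) * indicator B (T (- c + x) + y) \<partial>lborel)"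
      by (rule shift[symmetric]) measurable
    then show "(\<integral>\<^sup>+x. indicator A (T x) * indicator B (T x + y) \<partial>lborel) =
        (\<integral>\<^sup>+x. indicator A (T x - y) * indicator B (T x) \<partial>lborel)"
      by (simp add: linear_diff[OF lin] c)
  qed
  also have "\<dots> = (\<integral>\<^sup>+x. (\<integral>\<^sup>+y. indicator A (T x - y) * indicator B (T x) \<partial>lborel) \<partial>lborel)"
    by (intro lborel_pair.Fubini') measurable
  \<comment> \<open>Symmetry of the ball turns the reflection in \<open>y\<close> into a
    translation.\<close>
  also have "\<dots> = (\<integral>\<^sup>+x. (\<integral>\<^sup>+y. indicator A (- T x + y) \<partial>lborel) * indicator B (T x) \<partial>lborel)"
    unfolding A_minus by (simp add: nn_integral_multc)
  also have "\<dots> = (\<integral>\<^sup>+x. vA * indicator B (T x) \<partial>lborel)"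
    by (subst shift) (simp_all add: vA_def)
  also have "\<dots> = vA * emeasure (distr lborel borel T) B"
  proof -
    have "(\<integral>\<^sup>+x. indicator B x \<partial>distr lborel borel T) = (\<integral>\<^sup>+x. indicator B (T x) \<partial>lborel)"
      by (rule nn_integral_distr) measurable
    then show ?thesis by (simp add: nn_integral_cmult)
  qed
  finally show "emeasure (distr lborel borel T) B = emeasure lborel B"
    using vA by (auto simp: ennreal_mult_cancel_left)
qed simp

section \<open>Product Gaussian densities and their quadratic moments\<close>

lemma nn_integral_lborel_prod_cart:
  fixes f :: "'k::finite \<Rightarrow> real \<Rightarrow> ennreal"
  assumes [measurable]: "\<And>i. f i \<in> borel_measurable borel"
  shows "(\<integral>\<^sup>+x. (\<Prod>i\<in>UNIV. f i (x $ i)) \<partial>(lborel :: (real^'k) measure)) =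
    (\<Prod>i\<in>UNIV. \<integral>\<^sup>+x. f i x \<partial>lborel)"
proof -
  define ax where "ax = (\<lambda>i::'k. axis i (1::real))"
  have inj: "inj ax" by (auto simp: inj_on_def ax_def axis_eq_axis)
  have Basis: "(Basis :: (real^'k) set) = range ax"
    by (auto simp: Basis_vec_def ax_def)
  define F where "F = (\<lambda>b. f (inv ax b))"
  have F: "F (ax i) = f i" for i by (simp add: F_def inv_f_f[OF inj])
  have "(\<integral>\<^sup>+x. (\<Prod>b\<in>Basis. F b (x \<bullet> b)) \<partial>(lborel :: (real^'k) measure)) =
      (\<Prod>b\<in>(Basis :: (real^'k) set). \<integral>\<^sup>+x. F b x \<partial>lborel)"
    by (rule nn_integral_lborel_prod) (simp_all add: F_def)
  moreover have "(\<Prod>b\<in>Basis. F b (x \<bullet> b)) = (\<Prod>i\<in>UNIV. f i (x $ i))" for x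
    unfolding Basis prod.reindex[OF inj] by (simp add: F) (simp add: ax_def inner_axis)
  moreover have "(\<Prod>b\<in>(Basis :: (real^'k) set). \<integral>\<^sup>+x. F b x \<partial>lborel) = (\<Prod>i\<in>UNIV. \<integral>\<^sup>+x. f i x \<partial>lborel)"
    unfolding Basis by (subst prod.reindex[OF inj]) (simp add: F)
  ultimately show ?thesis by simp
qed

lemma nn_integral_normal_density:
  assumes "\<sigma> > 0"
  shows "(\<integral>\<^sup>+x. ennreal (normal_density m \<sigma> x) \<partial>lborel) = 1"
  using prob_space.emeasure_space_1[OF prob_space_normal_density[OF assms, of m]]
  by (simp add: emeasure_density)

lemma nn_integral_normal_density_second_moment:
  assumes "\<sigma> > 0"
  shows "(\<integral>\<^sup>+x. ennreal (normal_density 0 \<sigma> x * (x\<^sup>2 / \<sigma>\<^sup>2)) \<partial>lborel) = 1"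
proof -
  have "has_bochner_integral lborel (\<lambda>x. normal_density 0 \<sigma> x * x\<^sup>2) (\<sigma>\<^sup>2)"
    using normal_moment_even[OF assms, of 0 1] assms by (simp add: fact_numeral)
  then have "has_bochner_integral lborel (\<lambda>x. normal_density 0 \<sigma> x * x\<^sup>2 / \<sigma>\<^sup>2) (\<sigma>\<^sup>2 / \<sigma>\<^sup>2)"
    by (rule has_bochner_integral_divide_zero)
  then have "has_bochner_integral lborel (\<lambda>x. normal_density 0 \<sigma> x * (x\<^sup>2 / \<sigma>\<^sup>2)) 1"
    using assms by simp
  then show ?thesis
    using assms by (subst nn_integral_eq_integral)
      (auto simp: has_bochner_integral_iff intro!: AE_I2 mult_nonneg_nonneg divide_nonneg_nonneg)
qed

text \<open>One family for prior, noise and posterior: the first two have constant standard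
  deviations, and the posterior becomes diagonal after centering and rotating by
  \<open>V\<close>.\<close>

definition diagonal_normal_density :: "('k::finite \<Rightarrow> real) \<Rightarrow> real^'k \<Rightarrow> real" where
  "diagonal_normal_density \<sigma> x = (\<Prod>i\<in>UNIV. normal_density 0 (\<sigma> i) (x $ i))"

lemma borel_measurable_diagonal_normal_density [measurable]:
  "diagonal_normal_density \<sigma> \<in> borel_measurable borel"
  unfolding diagonal_normal_density_def by measurable

lemma diagonal_normal_density_pos:
  "(\<And>i. \<sigma> i > 0) \<Longrightarrow> diagonal_normal_density \<sigma> x > 0"
  by (simp add: diagonal_normal_density_def prod_pos normal_density_pos)

lemma diagonal_normal_density_eq_exp:
  "diagonal_normal_density \<sigma> x =
    (\<Prod>i\<in>UNIV. 1 / sqrt (2 * pi * (\<sigma> i)\<^sup>2)) * exp (- (\<Sum>i\<in>UNIV. (x $ i)\<^sup>2 / (\<sigma> i)\<^sup>2) / 2)"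
proof -
  have "- (\<Sum>i\<in>UNIV. (x $ i)\<^sup>2 / (\<sigma> i)\<^sup>2) / 2 = (\<Sum>i\<in>UNIV. - (x $ i)\<^sup>2 / (2 * (\<sigma> i)\<^sup>2))"
    by (simp add: sum_divide_distrib sum_negf mult.commute)
  then show ?thesis
    unfolding diagonal_normal_density_def normal_density_def prod.distrib
    by (simp add: exp_sum)
qed

lemma nn_integral_diagonal_normal_density:
  assumes "\<And>i. \<sigma> i > 0"
  shows "(\<integral>\<^sup>+x. ennreal (diagonal_normal_density \<sigma> x) \<partial>lborel) = 1"
  using assms
  by (simp add: diagonal_normal_density_def prod_ennreal[symmetric] nn_integral_normal_density
      nn_integral_lborel_prod_cart[of "\<lambda>i x. ennreal (normal_density 0 (\<sigma> i) x)"])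

text \<open>Each standardized square has mean one. For fixed \<open>i\<close> the square is absorbed
  into the \<open>i\<close>-th factor, so every summand is again a product and its integral
  factors.\<close>

lemma nn_integral_diagonal_normal_density_quadratic:
  fixes \<sigma> :: "'k::finite \<Rightarrow> real"
  assumes pos: "\<And>i. \<sigma> i > 0"
  shows "(\<integral>\<^sup>+x. ennreal (diagonal_normal_density \<sigma> x * (\<Sum>i\<in>UNIV. (x $ i)\<^sup>2 / (\<sigma> i)\<^sup>2)) \<partial>lborel) =
    ennreal (real CARD('k))"
proof -
  define f where "f = (\<lambda>i j x. ennreal (normal_density 0 (\<sigma> j) x * (if j = i then x\<^sup>2 / (\<sigma> j)\<^sup>2 else 1)))"
  have [measurable]: "f i j \<in> borel_measurable borel" for i j by (simp add: f_def)
  have f: "(\<integral>\<^sup>+x. f i j x \<partial>lborel) = 1" for i j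
    using nn_integral_normal_density_second_moment[OF pos] nn_integral_normal_density[OF pos, of 0]
    by (cases "j = i") (simp_all add: f_def)
  have "ennreal (diagonal_normal_density \<sigma> x * (\<Sum>i\<in>UNIV. (x $ i)\<^sup>2 / (\<sigma> i)\<^sup>2)) =
      (\<Sum>i\<in>UNIV. \<Prod>j\<in>UNIV. f i j (x $ j))" for x
  proof -
    have "(\<Prod>j\<in>UNIV. f i j (x $ j)) = ennreal (diagonal_normal_density \<sigma> x * ((x $ i)\<^sup>2 / (\<sigma> i)\<^sup>2))" for i
      unfolding f_def diagonal_normal_density_def
      by (subst prod_ennreal) (auto simp: prod.distrib prod.delta)
    then show ?thesis
      by (simp add: sum_ennreal sum_distrib_left diagonal_normal_density_pos[OF pos] less_imp_le)
  qed
  then show ?thesis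
    by (simp add: nn_integral_sum nn_integral_lborel_prod_cart f ennreal_of_nat_eq_real_of_nat)
qed

text \<open>Allows posterior integrals to be computed in eigenbasis coordinates centered at the
  posterior mean.\<close>

lemma nn_integral_orthogonal_affine:
  fixes V :: "real^'k^'k"
  assumes V: "orthogonal_matrix V" and [measurable]: "f \<in> borel_measurable borel"
  shows "(\<integral>\<^sup>+x. f (V *v (x - m)) \<partial>lborel) = (\<integral>\<^sup>+x. f x \<partial>lborel)"
proof -
  have T: "orthogonal_transformation ((*v) V)"
    using V by (simp add: orthogonal_transformation_matrix)
  have [measurable]: "(*v) V \<in> borel_measurable borel"
    by (intro borel_measurable_continuous_onI linear_continuous_on) simp
  have "(\<integral>\<^sup>+x. f x \<partial>lborel) = (\<integral>\<^sup>+x. f (V *v x) \<partial>lborel)"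
    by (subst lborel_distr_orthogonal_transformation[OF T, symmetric], subst nn_integral_distr) auto
  also have "\<dots> = (\<integral>\<^sup>+x. f (V *v (- m + x)) \<partial>lborel)"
    by (subst lborel_distr_plus[of "- m", symmetric], subst nn_integral_distr) auto
  finally show ?thesis by simp
qed

section \<open>Bayes factorization of the Gaussian model\<close>

lemma norm_sq_cart: "(norm x)\<^sup>2 = (\<Sum>i\<in>UNIV. (x $ i)\<^sup>2)" for x :: "real^'k"
  unfolding power2_norm_eq_inner by (simp add: inner_vec_def power2_eq_square)

lemma isotropic_normal_density_eq_diagonal:
  "(\<Prod>i\<in>UNIV. normal_density (m $ i) \<sigma> (x $ i)) = diagonal_normal_density (\<lambda>_. \<sigma>) (x - m)"
  by (simp add: diagonal_normal_density_def normal_density_def)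

locale diagonalized_model =
  fixes X :: "real^'p^'n" and \<sigma> \<tau> :: real and V :: "real^'p^'p" and \<mu> :: "'p \<Rightarrow> real"
  assumes \<sigma>: "\<sigma> > 0" and \<tau>: "\<tau> > 0"
    and V: "orthogonal_matrix V"
    and gram: "transpose X ** X = transpose V ** diagonal_matrix \<mu> ** V"
begin

abbreviation (input) prior_density :: "real^'p \<Rightarrow> real" where
  "prior_density \<equiv> diagonal_normal_density (\<lambda>_. \<tau>)"

abbreviation (input) noise_density :: "real^'n \<Rightarrow> real" where
  "noise_density \<equiv> diagonal_normal_density (\<lambda>_. \<sigma>)"

text \<open>Precisions add in the eigenbasis: \<open>\<mu> i / \<sigma>\<^sup>2\<close> comes from
  the likelihood and \<open>1 / \<tau>\<^sup>2\<close> from the prior.\<close>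

definition posterior_sd :: "'p \<Rightarrow> real" where
  "posterior_sd i = 1 / sqrt (\<mu> i / \<sigma>\<^sup>2 + 1 / \<tau>\<^sup>2)"

text \<open>The ridge estimator, with penalty the reciprocal of the prior-to-noise ratio.\<close>

definition posterior_mean :: "real^'n \<Rightarrow> real^'p" where
  "posterior_mean y =
    matrix_inv (transpose X ** X + (\<sigma>\<^sup>2 / \<tau>\<^sup>2) *\<^sub>R mat 1) *v (transpose X *v y)"

definition posterior_density :: "real^'n \<Rightarrow> real^'p \<Rightarrow> real" where
  "posterior_density y b = diagonal_normal_density posterior_sd (V *v (b - posterior_mean y))"

text \<open>The marginal density of the response without an integral: prior times likelihood over
  posterior, evaluated at the posterior mean, where the posterior density is
  \<open>diagonal_normal_density posterior_sd 0\<close>.\<close>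

definition evidence :: "real^'n \<Rightarrow> real" where
  "evidence y = prior_density (posterior_mean y) * noise_density (y - X *v posterior_mean y) /
    diagonal_normal_density posterior_sd 0"

lemma eigenvalue_nonneg: "\<mu> i \<ge> 0"
  by (rule gram_eigenvalue_nonneg[OF V gram])

lemma posterior_precision_pos: "\<mu> i / \<sigma>\<^sup>2 + 1 / \<tau>\<^sup>2 > 0"
  using eigenvalue_nonneg[of i] \<sigma> \<tau> by (intro add_nonneg_pos) auto

lemma posterior_sd_pos: "posterior_sd i > 0"
  using posterior_precision_pos by (simp add: posterior_sd_def)

lemma posterior_sd_sq: "1 / (posterior_sd i)\<^sup>2 = \<mu> i / \<sigma>\<^sup>2 + 1 / \<tau>\<^sup>2"
  using posterior_precision_pos[of i] by (simp add: posterior_sd_def power_divide)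

lemma posterior_quadratic_form:
  "(\<Sum>i\<in>UNIV. ((V *v b) $ i)\<^sup>2 / (posterior_sd i)\<^sup>2) = (norm (X *v b))\<^sup>2 / \<sigma>\<^sup>2 + (norm b)\<^sup>2 / \<tau>\<^sup>2"
proof -
  have "norm (V *v b) = norm b"
    using V by (simp add: orthogonal_transformation_matrix orthogonal_transformation_norm)
  then have nb: "(norm b)\<^sup>2 = (\<Sum>i\<in>UNIV. ((V *v b) $ i)\<^sup>2)"
    by (metis norm_sq_cart)
  have "((V *v b) $ i)\<^sup>2 / (posterior_sd i)\<^sup>2 =
      \<mu> i * ((V *v b) $ i)\<^sup>2 / \<sigma>\<^sup>2 + ((V *v b) $ i)\<^sup>2 / \<tau>\<^sup>2" for i
    using posterior_sd_sq[of i] by (simp add: divide_inverse algebra_simps)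
  then show ?thesis
    by (simp add: norm_sq_diagonalized_gram[OF V gram] nb sum.distrib sum_divide_distrib)
qed

text \<open>This makes the cross term vanish when the square is completed around the posterior mean.\<close>

lemma posterior_mean_normal_equation:
  "(X *v c) \<bullet> (y - X *v posterior_mean y) / \<sigma>\<^sup>2 = c \<bullet> posterior_mean y / \<tau>\<^sup>2"
proof -
  let ?\<alpha> = "\<sigma>\<^sup>2 / \<tau>\<^sup>2" and ?m = "posterior_mean y"
  have "\<mu> i + ?\<alpha> > 0" for i using eigenvalue_nonneg[of i] \<sigma> \<tau> by (intro add_nonneg_pos) auto
  then have "(transpose X ** X + ?\<alpha> *\<^sub>R mat 1) ** matrix_inv (transpose X ** X + ?\<alpha> *\<^sub>R mat 1) = mat 1"
    by (intro resolvent_right_inverse[OF V gram]) (metis less_irrefl)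
  then have "(transpose X ** X + ?\<alpha> *\<^sub>R mat 1) *v ?m = transpose X *v y"
    by (simp only: posterior_mean_def matrix_vector_mul_assoc) (simp add: matrix_mul_assoc)
  then have "transpose X *v (X *v ?m) + ?\<alpha> *\<^sub>R ?m = transpose X *v y"
    by (simp only: matrix_vector_mult_add_rdistrib scaleR_matrix_vector_assoc[symmetric]
        matrix_vector_mul_lid matrix_vector_mul_assoc)
  then have "c \<bullet> (transpose X *v (X *v ?m)) + ?\<alpha> * (c \<bullet> ?m) = c \<bullet> (transpose X *v y)"
    by (metis inner_add_right inner_scaleR_right)
  then have "(X *v c) \<bullet> (X *v ?m) + ?\<alpha> * (c \<bullet> ?m) = (X *v c) \<bullet> y"
    by (simp only: dot_lmul_matrix[symmetric] vector_transpose_matrix)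
  then have "(X *v c) \<bullet> (y - X *v ?m) = ?\<alpha> * (c \<bullet> ?m)"
    by (simp add: inner_diff_right)
  then show ?thesis using \<sigma> by simp
qed

text \<open>Substitute \<open>b = m + c\<close> with \<open>m\<close> the posterior mean. The cross
  terms from noise and prior cancel by the normal equation, and the terms quadratic in
  \<open>c\<close> form the posterior quadratic form.\<close>

lemma complete_the_square:
  "(norm (y - X *v b))\<^sup>2 / \<sigma>\<^sup>2 + (norm b)\<^sup>2 / \<tau>\<^sup>2 =
    (\<Sum>i\<in>UNIV. ((V *v (b - posterior_mean y)) $ i)\<^sup>2 / (posterior_sd i)\<^sup>2) +
    ((norm (y - X *v posterior_mean y))\<^sup>2 / \<sigma>\<^sup>2 + (norm (posterior_mean y))\<^sup>2 / \<tau>\<^sup>2)"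
proof -
  define m where "m = posterior_mean y"
  define c where "c = b - m"
  have b: "b = m + c" by (simp add: c_def)
  have sq: "(norm (z - w))\<^sup>2 = (norm z)\<^sup>2 + (norm w)\<^sup>2 - 2 * (w \<bullet> z)" for z w :: "real^'n"
    by (simp only: power2_norm_eq_inner) (simp add: inner_diff_left inner_diff_right inner_commute)
  have "y - X *v b = (y - X *v m) - X *v c"
    by (simp add: b matrix_vector_right_distrib)
  then have "(norm (y - X *v b))\<^sup>2 = (norm (y - X *v m))\<^sup>2 + (norm (X *v c))\<^sup>2 - 2 * ((X *v c) \<bullet> (y - X *v m))"
    by (simp only: sq[of "y - X *v m" "X *v c"])
  moreover have "(norm b)\<^sup>2 = (norm m)\<^sup>2 + (norm c)\<^sup>2 + 2 * (c \<bullet> m)"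
    by (simp only: power2_norm_eq_inner b) (simp add: inner_simps inner_commute algebra_simps)
  moreover have "(X *v c) \<bullet> (y - X *v m) / \<sigma>\<^sup>2 = c \<bullet> m / \<tau>\<^sup>2"
    unfolding m_def by (rule posterior_mean_normal_equation)
  ultimately show ?thesis
    unfolding posterior_quadratic_form m_def[symmetric] c_def[symmetric]
    by (simp add: add_divide_distrib diff_divide_distrib)
qed

text \<open>Completing the square splits the exponent into a posterior part and a part depending on
  \<open>y\<close> alone. The posterior constant \<open>?h\<close> cancels against the division in
  \<open>evidence\<close>.\<close>

lemma bayes_factorization:
  "prior_density b * noise_density (y - X *v b) = posterior_density y b * evidence y"
proof -
  let ?m = "posterior_mean y"
  let ?c = "\<Prod>i\<in>(UNIV :: 'p set). 1 / sqrt (2 * pi * \<tau>\<^sup>2)"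
  let ?d = "\<Prod>i\<in>(UNIV :: 'n set). 1 / sqrt (2 * pi * \<sigma>\<^sup>2)"
  let ?h = "\<Prod>i\<in>(UNIV :: 'p set). 1 / sqrt (2 * pi * (posterior_sd i)\<^sup>2)"
  have norm_sum: "(\<Sum>i\<in>UNIV. (x $ i)\<^sup>2 / s\<^sup>2) = (norm x)\<^sup>2 / s\<^sup>2" for x :: "real^'k" and s :: real
    by (simp add: norm_sq_cart sum_divide_distrib)
  have exps: "prior_density b * noise_density (y - X *v b) =
      ?c * ?d * exp (- ((norm (y - X *v b))\<^sup>2 / \<sigma>\<^sup>2 + (norm b)\<^sup>2 / \<tau>\<^sup>2) / 2)" for b
    unfolding diagonal_normal_density_eq_exp norm_sum
    by (simp add: exp_add[symmetric] add_divide_distrib diff_divide_distrib)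
  have h: "?h \<noteq> 0" using posterior_sd_pos by (simp add: less_imp_neq[symmetric])
  have ev: "evidence y = ?c * ?d / ?h * exp (- ((norm (y - X *v ?m))\<^sup>2 / \<sigma>\<^sup>2 + (norm ?m)\<^sup>2 / \<tau>\<^sup>2) / 2)"
    unfolding evidence_def exps by (simp add: diagonal_normal_density_eq_exp[of posterior_sd])
  have "posterior_density y b * evidence y = ?c * ?d *
      (exp (- (\<Sum>i\<in>UNIV. ((V *v (b - ?m)) $ i)\<^sup>2 / (posterior_sd i)\<^sup>2) / 2) *
       exp (- ((norm (y - X *v ?m))\<^sup>2 / \<sigma>\<^sup>2 + (norm ?m)\<^sup>2 / \<tau>\<^sup>2) / 2))"
    unfolding ev posterior_density_def diagonal_normal_density_eq_exp[of posterior_sd] using h by simp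
  also have "\<dots> = prior_density b * noise_density (y - X *v b)"
    unfolding exps complete_the_square[of y b]
    by (simp add: exp_add[symmetric] add_divide_distrib diff_divide_distrib)
  finally show ?thesis ..
qed

lemma density_pos:
  "prior_density b > 0" "noise_density z > 0" "posterior_density y b > 0" "evidence y > 0"
  using \<sigma> \<tau> posterior_sd_pos
  by (auto simp: posterior_density_def evidence_def intro!: diagonal_normal_density_pos
      divide_pos_pos mult_pos_pos)

text \<open>The factors \<open>2 * pi\<close> drop out of the normalizing constants, leaving the
  variance ratios \<open>\<tau>\<^sup>2 / (posterior_sd i)\<^sup>2\<close>, which equal
  \<open>1 + \<tau>\<^sup>2 / \<sigma>\<^sup>2 * \<mu> i\<close>.\<close>

lemma posterior_to_prior_log_ratio:
  "ln (posterior_density y b / prior_density b) =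
    1 / 2 * (\<Sum>i\<in>UNIV. ln (1 + \<tau>\<^sup>2 / \<sigma>\<^sup>2 * \<mu> i)) + (\<Sum>i\<in>UNIV. (b $ i)\<^sup>2 / \<tau>\<^sup>2) / 2 -
    (\<Sum>i\<in>UNIV. ((V *v (b - posterior_mean y)) $ i)\<^sup>2 / (posterior_sd i)\<^sup>2) / 2"
proof -
  define Q where "Q = (\<Sum>i\<in>UNIV. ((V *v (b - posterior_mean y)) $ i)\<^sup>2 / (posterior_sd i)\<^sup>2)"
  define R where "R = (\<Sum>i\<in>UNIV. (b $ i)\<^sup>2 / \<tau>\<^sup>2)"
  have const: "ln (1 / sqrt (2 * pi * (posterior_sd i)\<^sup>2)) - ln (1 / sqrt (2 * pi * \<tau>\<^sup>2)) =
      1 / 2 * ln (1 + \<tau>\<^sup>2 / \<sigma>\<^sup>2 * \<mu> i)" for i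
  proof -
    have "1 + \<tau>\<^sup>2 / \<sigma>\<^sup>2 * \<mu> i = \<tau>\<^sup>2 / (posterior_sd i)\<^sup>2"
      using posterior_sd_sq[of i] \<tau> by (simp add: divide_inverse algebra_simps)
    then show ?thesis
      using posterior_sd_pos[of i] \<tau> by (simp add: ln_div ln_mult ln_sqrt ln_realpow)
        (simp add: add_divide_distrib)
  qed
  have "ln (posterior_density y b) = (\<Sum>i\<in>UNIV. ln (1 / sqrt (2 * pi * (posterior_sd i)\<^sup>2))) - Q / 2"
    unfolding posterior_density_def diagonal_normal_density_eq_exp Q_def[symmetric]
    by (subst ln_mult_pos) (auto intro!: prod_pos simp: ln_prod posterior_sd_pos less_imp_neq[symmetric])
  moreover have "ln (prior_density b) = (\<Sum>i\<in>(UNIV :: 'p set). ln (1 / sqrt (2 * pi * \<tau>\<^sup>2))) - R / 2"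
    unfolding diagonal_normal_density_eq_exp R_def[symmetric] using \<tau>
    by (subst ln_mult_pos) (auto intro!: prod_pos simp: ln_prod simp del: prod_constant)
  ultimately have "ln (posterior_density y b / prior_density b) =
      (\<Sum>i\<in>UNIV. ln (1 / sqrt (2 * pi * (posterior_sd i)\<^sup>2)) - ln (1 / sqrt (2 * pi * \<tau>\<^sup>2))) + R / 2 - Q / 2"
    by (simp only: ln_divide_pos[OF density_pos(3) density_pos(1)] sum_subtractf)
  then show ?thesis unfolding const Q_def R_def by (simp add: sum_distrib_left)
qed

end

section \<open>Mutual information\<close>

lemma borel_measurable_matrix_vector_mult [measurable (raw)]:
  fixes A :: "real^'k^'l"
  assumes "f \<in> borel_measurable M"
  shows "(\<lambda>x. A *v f x) \<in> borel_measurable M"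
proof -
  have "(*v) A \<in> borel_measurable borel"
    by (intro borel_measurable_continuous_onI linear_continuous_on) simp
  then show ?thesis using assms by (rule measurable_compose_rev)
qed

lemma borel_measurable_vec_nth_compose [measurable (raw)]:
  "f \<in> borel_measurable M \<Longrightarrow> (\<lambda>x. f x $ i) \<in> borel_measurable M" for f :: "'a \<Rightarrow> real^'k"
  by (rule measurable_compose[OF _ borel_measurable_nth])

locale diagonalized_regression =
  gaussian_regression M X \<sigma> \<tau> \<beta> Y + diagonalized_model X \<sigma> \<tau> V \<mu>
  for M :: "'a measure" and X :: "real^'p^'n" and \<sigma> \<tau> \<beta> Y V \<mu>
begin

section \<open>The joint law and its marginals\<close>

definition joint_density :: "(real^'p) \<times> (real^'n) \<Rightarrow> real" where
  "joint_density = (\<lambda>(b, y). prior_density b * noise_density (y - X *v b))"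

lemma borel_measurable_joint_density [measurable]:
  "joint_density \<in> borel_measurable (lborel \<Otimes>\<^sub>M lborel)"
  unfolding joint_density_def by measurable

lemma isotropic_normal_eq_density:
  "isotropic_normal m s = density lborel (\<lambda>x. ennreal (diagonal_normal_density (\<lambda>_. s) (x - m)))"
  by (simp add: isotropic_normal_def isotropic_normal_density_eq_diagonal)

lemma distributed_prior: "distributed M lborel \<beta> (\<lambda>b. ennreal (prior_density b))"
proof -
  \<comment> \<open>A push-forward depends on its target only through the sigma-algebra, which
    \<open>borel\<close> and \<open>lborel\<close> share.\<close>
  have "distr M lborel \<beta> = distr M borel \<beta>" by (intro distr_cong) auto
  then show ?thesis
    using prior measurable_param by (simp add: distributed_def isotropic_normal_eq_density)
qed

text \<open>The assumption \<open>likelihood\<close> fixes the law of the pair on measurable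
  rectangles. These form an intersection-stable generator and the law is finite, so agreement there
  suffices.\<close>

lemma distributed_joint:
  "distributed M (lborel \<Otimes>\<^sub>M lborel) (\<lambda>\<omega>. (\<beta> \<omega>, Y \<omega>)) (\<lambda>p. ennreal (joint_density p))"
proof -
  note [measurable] = measurable_param measurable_response
  let ?L = "(lborel :: (real^'p) measure) \<Otimes>\<^sub>M (lborel :: (real^'n) measure)"
  let ?E = "{A \<times> B |A B. A \<in> sets (lborel :: (real^'p) measure) \<and> B \<in> sets (lborel :: (real^'n) measure)}"
  have meas: "(\<lambda>\<omega>. (\<beta> \<omega>, Y \<omega>)) \<in> M \<rightarrow>\<^sub>M ?L" by measurable
  have "distr M ?L (\<lambda>\<omega>. (\<beta> \<omega>, Y \<omega>)) = density ?L (\<lambda>p. ennreal (joint_density p))"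
  proof (rule measure_eqI_generator_eq[where E = ?E and \<Omega> = UNIV and A = "\<lambda>_. UNIV"])
    show "Int_stable ?E" by (rule Int_stable_pair_measure_generator)
    show "sets (distr M ?L (\<lambda>\<omega>. (\<beta> \<omega>, Y \<omega>))) = sigma_sets UNIV ?E"
      "sets (density ?L (\<lambda>p. ennreal (joint_density p))) = sigma_sets UNIV ?E"
      by (simp_all add: sets_pair_measure)
    show "range (\<lambda>_. UNIV) \<subseteq> ?E" by (auto intro!: exI[of _ UNIV])
    have "prob_space (distr M ?L (\<lambda>\<omega>. (\<beta> \<omega>, Y \<omega>)))" by (rule prob_space_distr[OF meas])
    then show "emeasure (distr M ?L (\<lambda>\<omega>. (\<beta> \<omega>, Y \<omega>))) UNIV \<noteq> \<infinity>"
      using prob_space.emeasure_space_1 by (fastforce simp: space_pair_measure)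
  next
    fix S assume "S \<in> ?E"
    then obtain A B where S: "S = A \<times> B" and [measurable]: "A \<in> sets borel" "B \<in> sets borel" by auto
    have cond: "emeasure (isotropic_normal (X *v b) \<sigma>) B =
        (\<integral>\<^sup>+y. ennreal (noise_density (y - X *v b)) * indicator B y \<partial>lborel)" for b
      by (simp add: isotropic_normal_eq_density emeasure_density)
    have "emeasure (distr M ?L (\<lambda>\<omega>. (\<beta> \<omega>, Y \<omega>))) S =
        emeasure M {\<omega> \<in> space M. \<beta> \<omega> \<in> A \<and> Y \<omega> \<in> B}"
      unfolding S using meas by (subst emeasure_distr) (auto intro!: arg_cong[where f = "emeasure M"])
    also have "\<dots> = (\<integral>\<^sup>+b. ennreal (prior_density b) *
        ((\<integral>\<^sup>+y. ennreal (noise_density (y - X *v b)) * indicator B y \<partial>lborel) * indicator A b) \<partial>lborel)"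
      unfolding likelihood[OF \<open>A \<in> sets borel\<close> \<open>B \<in> sets borel\<close>] prior cond
      by (simp add: isotropic_normal_eq_density nn_integral_density)
    also have "\<dots> = (\<integral>\<^sup>+b. (\<integral>\<^sup>+y. ennreal (joint_density (b, y)) * indicator S (b, y) \<partial>lborel) \<partial>lborel)"
      by (intro nn_integral_cong)
        (simp add: joint_density_def S ennreal_mult density_pos less_imp_le indicator_times mult_ac
          flip: nn_integral_cmult nn_integral_multc)
    also have "\<dots> = (\<integral>\<^sup>+p. ennreal (joint_density p) * indicator S p \<partial>?L)"
      unfolding S by (rule lborel.nn_integral_fst) measurable
    also have "\<dots> = emeasure (density ?L (\<lambda>p. ennreal (joint_density p))) S"
      unfolding S by (rule emeasure_density[symmetric]) measurable
    finally show "emeasure (distr M ?L (\<lambda>\<omega>. (\<beta> \<omega>, Y \<omega>))) S =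
      emeasure (density ?L (\<lambda>p. ennreal (joint_density p))) S" .
  qed auto
  with meas show ?thesis by (simp add: distributed_def)
qed

lemma borel_measurable_posterior_density [measurable]:
  "posterior_density y \<in> borel_measurable borel"
  unfolding posterior_density_def by measurable

lemma joint_density_eq_posterior: "joint_density (b, y) = posterior_density y b * evidence y"
  by (simp add: joint_density_def bayes_factorization)

lemma joint_density_pos: "joint_density p > 0"
  by (cases p) (simp add: joint_density_def density_pos)

lemma nn_integral_posterior_density: "(\<integral>\<^sup>+b. ennreal (posterior_density y b) \<partial>lborel) = 1"
  unfolding posterior_density_def
  by (subst nn_integral_orthogonal_affine[OF V]) (simp_all add: nn_integral_diagonal_normal_density posterior_sd_pos)

lemma nn_integral_noise_density: "(\<integral>\<^sup>+y. ennreal (noise_density (y - z)) \<partial>lborel) = 1"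
  using nn_integral_orthogonal_affine[OF orthogonal_matrix_id, of "\<lambda>y. ennreal (noise_density y)" z]
  by (simp add: nn_integral_diagonal_normal_density \<sigma>)

text \<open>For each \<open>y\<close> the posterior density integrates to one, so integrating
  \<open>b\<close> out of the Bayes factorization leaves \<open>evidence y\<close>.\<close>

lemma distributed_evidence: "distributed M lborel Y (\<lambda>y. ennreal (evidence y))"
proof -
  have "(\<integral>\<^sup>+b. ennreal (joint_density (b, y)) \<partial>lborel) = ennreal (evidence y)" for y
  proof -
    have "(\<integral>\<^sup>+b. ennreal (joint_density (b, y)) \<partial>lborel) =
        (\<integral>\<^sup>+b. ennreal (posterior_density y b) * ennreal (evidence y) \<partial>lborel)"
      by (simp add: joint_density_eq_posterior ennreal_mult density_pos less_imp_le)
    then show ?thesis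
      by (simp add: nn_integral_multc nn_integral_posterior_density)
  qed
  then show ?thesis
    using distr_marginal2[OF sigma_finite_lborel sigma_finite_lborel distributed_joint] by simp
qed

section \<open>Expectations of the two quadratic forms\<close>

definition prior_quadratic :: "real^'p \<Rightarrow> real" where
  "prior_quadratic b = (\<Sum>i\<in>UNIV. (b $ i)\<^sup>2 / \<tau>\<^sup>2)"

definition posterior_quadratic :: "real^'n \<Rightarrow> real^'p \<Rightarrow> real" where
  "posterior_quadratic y b = (\<Sum>i\<in>UNIV. ((V *v (b - posterior_mean y)) $ i)\<^sup>2 / (posterior_sd i)\<^sup>2)"

lemma has_bochner_integral_joint_density:
  "has_bochner_integral (lborel \<Otimes>\<^sub>M lborel) joint_density 1"
proof (rule has_bochner_integral_nn_integral)
  have "prob_space (density (lborel \<Otimes>\<^sub>M lborel) (\<lambda>p. ennreal (joint_density p)))"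
    using prob_space_distr[OF distributed_measurable[OF distributed_joint]]
      by (simp add: distributed_distr_eq_density[OF distributed_joint])
  from prob_space.emeasure_space_1[OF this]
  have "1 = emeasure (density (lborel \<Otimes>\<^sub>M lborel) (\<lambda>p. ennreal (joint_density p))) (space (lborel \<Otimes>\<^sub>M lborel))"
    by simp
  also have "\<dots> = (\<integral>\<^sup>+p. ennreal (joint_density p) * indicator (space (lborel \<Otimes>\<^sub>M lborel)) p
      \<partial>(lborel \<Otimes>\<^sub>M lborel))"
    by (rule emeasure_density) measurable
  also have "\<dots> = (\<integral>\<^sup>+p. ennreal (joint_density p) \<partial>(lborel \<Otimes>\<^sub>M lborel))"
    by (rule nn_integral_cong) simp
  finally show "(\<integral>\<^sup>+p. ennreal (joint_density p) \<partial>(lborel \<Otimes>\<^sub>M lborel)) = ennreal 1"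
    by simp
qed (auto simp: joint_density_pos less_imp_le)

text \<open>Tonelli with \<open>y\<close> innermost: the noise integrates to one, leaving the prior
  expectation.\<close>

lemma has_bochner_integral_prior_quadratic:
  "has_bochner_integral (lborel \<Otimes>\<^sub>M lborel) (\<lambda>p. joint_density p * prior_quadratic (fst p)) (real CARD('p))"
proof (rule has_bochner_integral_nn_integral)
  have nn: "prior_quadratic b \<ge> 0" for b by (simp add: prior_quadratic_def sum_nonneg)
  have [measurable]: "prior_quadratic \<in> borel_measurable borel" unfolding prior_quadratic_def by measurable
  show "(\<lambda>p. joint_density p * prior_quadratic (fst p)) \<in> borel_measurable (lborel \<Otimes>\<^sub>M lborel)" by measurable
  show "AE p in lborel \<Otimes>\<^sub>M lborel. 0 \<le> joint_density p * prior_quadratic (fst p)"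
    by (simp add: nn joint_density_pos less_imp_le)
  have "(\<integral>\<^sup>+p. ennreal (joint_density p * prior_quadratic (fst p)) \<partial>(lborel \<Otimes>\<^sub>M lborel)) =
      (\<integral>\<^sup>+b. (\<integral>\<^sup>+y. ennreal (joint_density (b, y) * prior_quadratic b) \<partial>lborel) \<partial>lborel)"
    by (subst lborel.nn_integral_fst[symmetric]) simp_all
  also have "\<dots> = (\<integral>\<^sup>+b. ennreal (prior_density b * prior_quadratic b) *
      (\<integral>\<^sup>+y. ennreal (noise_density (y - X *v b)) \<partial>lborel) \<partial>lborel)"
  proof (rule nn_integral_cong)
    fix b
    have "ennreal (joint_density (b, y) * prior_quadratic b) =
        ennreal (prior_density b * prior_quadratic b) * ennreal (noise_density (y - X *v b))" for y
      by (simp add: joint_density_def density_pos less_imp_le nn mult_ac flip: ennreal_mult)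
    then show "(\<integral>\<^sup>+y. ennreal (joint_density (b, y) * prior_quadratic b) \<partial>lborel) =
        ennreal (prior_density b * prior_quadratic b) *
        (\<integral>\<^sup>+y. ennreal (noise_density (y - X *v b)) \<partial>lborel)"
      by (simp add: nn_integral_cmult)
  qed
  also have "\<dots> = ennreal (real CARD('p))"
    unfolding nn_integral_noise_density prior_quadratic_def using \<tau>
    by (simp add: nn_integral_diagonal_normal_density_quadratic)
  finally show "(\<integral>\<^sup>+p. ennreal (joint_density p * prior_quadratic (fst p)) \<partial>(lborel \<Otimes>\<^sub>M lborel)) =
      ennreal (real CARD('p))" .
qed simp

text \<open>Tonelli in the other order: given any \<open>y\<close> the posterior expectation is
  already \<open>CARD('p)\<close>, and the evidence then integrates to one.\<close>

lemma has_bochner_integral_posterior_quadratic: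
  "has_bochner_integral (lborel \<Otimes>\<^sub>M lborel)
    (\<lambda>p. joint_density p * posterior_quadratic (snd p) (fst p)) (real CARD('p))"
proof (rule has_bochner_integral_nn_integral)
  have nn: "posterior_quadratic y b \<ge> 0" for y b by (simp add: posterior_quadratic_def sum_nonneg)
  have [measurable]: "(\<lambda>p. posterior_quadratic (snd p) (fst p)) \<in> borel_measurable (lborel \<Otimes>\<^sub>M lborel)"
    unfolding posterior_quadratic_def posterior_mean_def by measurable
  show "(\<lambda>p. joint_density p * posterior_quadratic (snd p) (fst p)) \<in> borel_measurable (lborel \<Otimes>\<^sub>M lborel)"
    by measurable
  show "AE p in lborel \<Otimes>\<^sub>M lborel. 0 \<le> joint_density p * posterior_quadratic (snd p) (fst p)"
    by (simp add: nn joint_density_pos less_imp_le)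
  have inner: "(\<integral>\<^sup>+b. ennreal (posterior_density y b * posterior_quadratic y b) \<partial>lborel) =
      ennreal (real CARD('p))" for y
    unfolding posterior_density_def posterior_quadratic_def
    by (subst nn_integral_orthogonal_affine[OF V, where f = "\<lambda>x. ennreal (diagonal_normal_density posterior_sd x *
        (\<Sum>i\<in>UNIV. (x $ i)\<^sup>2 / (posterior_sd i)\<^sup>2))"])
      (simp_all add: nn_integral_diagonal_normal_density_quadratic posterior_sd_pos)
  have [measurable]: "(\<lambda>b. posterior_density y b * posterior_quadratic y b) \<in> borel_measurable borel" for y
    unfolding posterior_density_def posterior_quadratic_def by measurable
  have "(\<integral>\<^sup>+p. ennreal (joint_density p * posterior_quadratic (snd p) (fst p)) \<partial>(lborel \<Otimes>\<^sub>M lborel)) =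
      (\<integral>\<^sup>+y. (\<integral>\<^sup>+b. ennreal (joint_density (b, y) * posterior_quadratic y b) \<partial>lborel) \<partial>lborel)"
    by (subst lborel_pair.nn_integral_snd[symmetric]) simp_all
  also have "\<dots> = (\<integral>\<^sup>+y. (\<integral>\<^sup>+b. ennreal (evidence y) *
      ennreal (posterior_density y b * posterior_quadratic y b) \<partial>lborel) \<partial>lborel)"
    by (intro nn_integral_cong)
      (simp add: joint_density_eq_posterior density_pos less_imp_le nn mult_ac flip: ennreal_mult)
  also have "\<dots> = (\<integral>\<^sup>+y. ennreal (evidence y) * ennreal (real CARD('p)) \<partial>lborel)"
    by (simp add: nn_integral_cmult inner)
  also have "\<dots> = (\<integral>\<^sup>+y. ennreal (evidence y) \<partial>lborel) * ennreal (real CARD('p))"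
    using distributed_evidence by (intro nn_integral_multc) (simp add: distributed_def)
  also have "(\<integral>\<^sup>+y. ennreal (evidence y) \<partial>lborel) = 1"
  proof -
    have "prob_space (density lborel (\<lambda>y. ennreal (evidence y)))"
      using prob_space_distr[OF distributed_measurable[OF distributed_evidence]]
      by (simp add: distributed_distr_eq_density[OF distributed_evidence])
    from prob_space.emeasure_space_1[OF this] show ?thesis
      using distributed_evidence by (simp add: emeasure_density distributed_def)
  qed
  finally show "(\<integral>\<^sup>+p. ennreal (joint_density p * posterior_quadratic (snd p) (fst p)) \<partial>(lborel \<Otimes>\<^sub>M lborel)) =
      ennreal (real CARD('p))" by simp
qed simp

text \<open>By Bayes factorization the ratio of the joint density to the product of marginals is
  posterior over prior, whose logarithm is a constant plus half the difference of two forms of equal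
  mean.\<close>

theorem mutual_information_eq:
  "mutual_information (exp 1) borel borel \<beta> Y = 1 / 2 * (\<Sum>i\<in>UNIV. ln (1 + \<tau>\<^sup>2 / \<sigma>\<^sup>2 * \<mu> i))"
proof -
  interpret information_space M "exp 1" by unfold_locales simp
  let ?L = "(lborel :: (real^'p) measure) \<Otimes>\<^sub>M (lborel :: (real^'n) measure)"
  let ?C = "1 / 2 * (\<Sum>i\<in>UNIV. ln (1 + \<tau>\<^sup>2 / \<sigma>\<^sup>2 * \<mu> i))"
  have "mutual_information (exp 1) borel borel \<beta> Y = mutual_information (exp 1) lborel lborel \<beta> Y"
  proof -
    have "distr M borel \<beta> = distr M lborel \<beta>" "distr M borel Y = distr M lborel Y"
      "distr M (borel \<Otimes>\<^sub>M borel) (\<lambda>\<omega>. (\<beta> \<omega>, Y \<omega>)) = distr M (lborel \<Otimes>\<^sub>M lborel) (\<lambda>\<omega>. (\<beta> \<omega>, Y \<omega>))"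
      by (auto intro!: distr_cong sets_pair_measure_cong)
    then show ?thesis by (simp add: mutual_information_def)
  qed
  also have "\<dots> = (\<integral>p. joint_density p * log (exp 1)
      (joint_density p / (prior_density (fst p) * evidence (snd p))) \<partial>?L)"
    by (rule mutual_information_distr)
      (use sigma_finite_lborel distributed_prior distributed_evidence distributed_joint density_pos
        joint_density_pos in \<open>auto simp: less_imp_le\<close>)
  also have "\<dots> = (\<integral>p. joint_density p * ?C + joint_density p * prior_quadratic (fst p) / 2 -
      joint_density p * posterior_quadratic (snd p) (fst p) / 2 \<partial>?L)"
  proof (rule Bochner_Integration.integral_cong)
    fix p :: "(real^'p) \<times> (real^'n)"
    obtain b y where p: "p = (b, y)" by (cases p)
    have "joint_density (b, y) / (prior_density b * evidence y) = posterior_density y b / prior_density b"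
      using density_pos(4)[of y] by (simp add: joint_density_eq_posterior)
    then have "log (exp 1) (joint_density (b, y) / (prior_density b * evidence y)) =
        ?C + prior_quadratic b / 2 - posterior_quadratic y b / 2"
      by (simp only: log_def ln_exp posterior_to_prior_log_ratio prior_quadratic_def posterior_quadratic_def div_by_1)
    then show "joint_density p * log (exp 1) (joint_density p / (prior_density (fst p) * evidence (snd p))) =
        joint_density p * ?C + joint_density p * prior_quadratic (fst p) / 2 -
        joint_density p * posterior_quadratic (snd p) (fst p) / 2"
      by (simp only: p fst_conv snd_conv) (simp add: algebra_simps)
  qed simp
  \<comment> \<open>Each summand is integrable with known value, which justifies linearity.\<close>
  also have "\<dots> = 1 * ?C + real CARD('p) / 2 - real CARD('p) / 2"
    by (intro has_bochner_integral_integral_eq has_bochner_integral_diff has_bochner_integral_add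
        has_bochner_integral_divide_zero has_bochner_integral_mult_left
        has_bochner_integral_joint_density has_bochner_integral_prior_quadratic
        has_bochner_integral_posterior_quadratic)
  finally show ?thesis by simp
qed

end

section \<open>Ridge degrees of freedom\<close>

text \<open>Cyclicity of the trace moves \<open>transpose X\<close> past the outer \<open>X\<close>,
  leaving the resolvent times the Gram matrix.\<close>

lemma ridge_df_eq_sum_eigenvalues:
  fixes X :: "real^'p^'n"
  assumes V: "orthogonal_matrix V"
    and gram: "transpose X ** X = transpose V ** diagonal_matrix \<mu> ** V"
    and \<alpha>: "\<alpha> > 0"
  shows "ridge_df X \<alpha> = (\<Sum>i\<in>UNIV. \<mu> i / (\<mu> i + \<alpha>))"
proof -
  have "\<mu> i + \<alpha> \<noteq> 0" for i
    using gram_eigenvalue_nonneg[OF V gram, of i] \<alpha> by simp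
  then have "trace (matrix_inv (transpose X ** X + \<alpha> *\<^sub>R mat 1) ** (transpose X ** X)) =
      (\<Sum>i\<in>UNIV. \<mu> i / (\<mu> i + \<alpha>))"
    by (rule trace_resolvent_diagonalized[OF V gram])
  then show ?thesis
    unfolding ridge_df_def by (subst matrix_mul_assoc[symmetric], subst trace_mul_sym) (simp only: matrix_mul_assoc)
qed

text \<open>Every ratio \<open>l\<close> has its own model, with \<open>\<sigma> l\<close> and
  \<open>\<tau> l\<close> constrained only by positivity and their ratio; base \<open>exp 1\<close>
  gives natural logarithms. Differentiability and integrability are asserted explicitly because
  \<open>deriv\<close> and the integral are total and would otherwise carry no such
  information.\<close>

theorem proposition6:
  fixes X :: "real^'p^'n" and r :: nat and s :: "nat \<Rightarrow> real"
    and M :: "real \<Rightarrow> 'a measure" and \<sigma> \<tau> :: "real \<Rightarrow> real"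
    and \<beta> :: "real \<Rightarrow> 'a \<Rightarrow> real^'p" and Y :: "real \<Rightarrow> 'a \<Rightarrow> real^'n"
    and \<I> :: "real \<Rightarrow> real"
  assumes "rank X = r"
    and "nonzero_singular_values X r s"
    and "\<And>l. 0 < l \<Longrightarrow> gaussian_regression (M l) X (\<sigma> l) (\<tau> l) (\<beta> l) (Y l)"
    and "\<And>l. 0 < l \<Longrightarrow> (\<tau> l)\<^sup>2 / (\<sigma> l)\<^sup>2 = l"
    and "\<And>l. 0 < l \<Longrightarrow>
      \<I> l = prob_space.mutual_information (M l) (exp 1) borel borel (\<beta> l) (Y l)"
  shows "(\<forall>l>0. \<I> l = 1 / 2 * (\<Sum>j=1..r. ln (1 + l * (s j)\<^sup>2))) \<and>
    (\<forall>\<alpha>>0. ridge_df X \<alpha> = (\<Sum>j=1..r. (s j)\<^sup>2 / ((s j)\<^sup>2 + \<alpha>))) \<and>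
    (\<forall>l>0. \<I> differentiable (at l) \<and> 2 * l * deriv \<I> l = ridge_df X (1 / l)) \<and>
    (\<forall>l>0. set_integrable lborel {0<..l} (\<lambda>t. ridge_df X (1 / t) / t) \<and>
      2 * \<I> l = (LBINT t:{0<..l}. ridge_df X (1 / t) / t))"
proof -
  have "transpose (transpose X ** X) = transpose X ** X"
    by (simp add: matrix_transpose_mul)
  then obtain V \<mu> where V: "orthogonal_matrix V"
    and gram: "transpose X ** X = transpose V ** diagonal_matrix \<mu> ** V"
    by (rule symmetric_matrix_diagonalization)
  \<comment> \<open>Used for \<open>ln (1 + l * c)\<close> and \<open>c / (c + \<alpha>)\<close>,
    both zero at \<open>c = 0\<close>.\<close>
  note sum_eq = sum_nonzero_singular_values[OF V gram assms(2)]
  define J where "J = (\<lambda>t. \<Sum>j=1..r. ln (1 + t * (s j)\<^sup>2))"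
  \<comment> \<open>\<open>D t\<close> is \<open>ridge_df X (1 / t) / t\<close> for positive
    \<open>t\<close>, written so that it stays continuous at zero; \<open>J\<close> likewise extends
    twice the information to zero.\<close>
  define D where "D = (\<lambda>t. \<Sum>j=1..r. (s j)\<^sup>2 / (1 + t * (s j)\<^sup>2))"
  have I: "\<I> l = 1 / 2 * J l" if l: "l > 0" for l
  proof -
    interpret gaussian_regression "M l" X "\<sigma> l" "\<tau> l" "\<beta> l" "Y l" using assms(3)[OF l] .
    interpret diagonalized_regression "M l" X "\<sigma> l" "\<tau> l" "\<beta> l" "Y l" V \<mu>
      by unfold_locales (use sd_pos V gram in auto)
    show ?thesis
      using mutual_information_eq sum_eq[of "\<lambda>c. ln (1 + l * c)"]
      by (simp add: assms(5)[OF l] assms(4)[OF l] J_def)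
  qed
  have df: "ridge_df X \<alpha> = (\<Sum>j=1..r. (s j)\<^sup>2 / ((s j)\<^sup>2 + \<alpha>))" if "\<alpha> > 0" for \<alpha>
    using ridge_df_eq_sum_eigenvalues[OF V gram that] sum_eq[of "\<lambda>c. c / (c + \<alpha>)"] by simp
  have pos: "1 + t * (s j)\<^sup>2 > 0" if "t \<ge> 0" for t j
    using that by (simp add: add_pos_nonneg)
  have df_D: "ridge_df X (1 / t) = t * D t" if t: "t > 0" for t
  proof -
    have "(s j)\<^sup>2 / ((s j)\<^sup>2 + 1 / t) = t * ((s j)\<^sup>2 / (1 + t * (s j)\<^sup>2))" for j
      using pos[of t j] t by (simp add: field_simps)
    then show ?thesis using t by (simp add: df D_def sum_distrib_left)
  qed
  have J_deriv: "(J has_real_derivative D t) (at t)" if "t \<ge> 0" for t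
    unfolding J_def D_def
    by (rule derivative_eq_intros refl pos[OF that] | simp)+
  have I_deriv: "(\<I> has_real_derivative 1 / 2 * D l) (at l)" if l: "l > 0" for l
  \<comment> \<open>The formula for \<open>\<I>\<close> is known only for positive arguments, so the
    derivative is transferred through a neighbourhood of \<open>l\<close>.\<close>
  proof (rule DERIV_cong_ev[THEN iffD2, OF refl _ refl])
    show "\<forall>\<^sub>F x in nhds l. \<I> x = 1 / 2 * J x"
      using eventually_nhds_in_open[of "{0<..}" l] l by (auto elim!: eventually_mono simp: I)
    show "((\<lambda>x. 1 / 2 * J x) has_real_derivative 1 / 2 * D l) (at l)"
      using l by (intro DERIV_cmult J_deriv) simp
  qed
  have D_int: "set_integrable lborel {0<..l} D" and D_value: "(LBINT t:{0<..l}. D t) = J l"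
    if l: "l > 0" for l
  proof -
    have cont: "continuous_on {0..l} D"
      unfolding D_def using pos by (intro continuous_intros) (metis atLeastAtMost_iff less_irrefl)
    then have "set_integrable lborel {0..l} D" by (rule borel_integrable_atLeastAtMost')
    then show "set_integrable lborel {0<..l} D" by (rule set_integrable_subset) auto
    \<comment> \<open>The extension to zero permits the fundamental theorem on the closed interval;
      the boundary term \<open>J 0\<close> is a sum of \<open>ln 1\<close> and vanishes.\<close>
    have "(LBINT t=ereal 0..ereal l. D t) = J l - J 0"
    proof (rule interval_integral_FTC_finite)
      show "continuous_on {min 0 l..max 0 l} D" using cont l by simp
      show "(J has_vector_derivative D t) (at t within {min 0 l..max 0 l})" if "min 0 l \<le> t" for t
        using J_deriv[of t] that l
        by (auto simp: has_real_derivative_iff_has_vector_derivative intro: has_vector_derivative_at_within)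
    qed
    then show "(LBINT t:{0<..l}. D t) = J l"
      using l by (subst interval_integral_Ioc[symmetric]) (simp_all add: J_def)
  qed
  have "set_integrable lborel {0<..l} (\<lambda>t. ridge_df X (1 / t) / t) \<and>
      2 * \<I> l = (LBINT t:{0<..l}. ridge_df X (1 / t) / t)" if l: "l > 0" for l
  proof -
    have eq: "ridge_df X (1 / t) / t = D t" if "t \<in> {0<..l}" for t using that df_D by simp
    have "set_integrable lborel {0<..l} (\<lambda>t. ridge_df X (1 / t) / t)"
      using D_int[OF l] unfolding set_integrable_def
      by (rule back_subst[where P = "integrable lborel"]) (auto simp: indicator_def eq)
    moreover have "(LBINT t:{0<..l}. ridge_df X (1 / t) / t) = (LBINT t:{0<..l}. D t)"
      by (rule set_lebesgue_integral_cong) (auto simp: eq)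
    ultimately show ?thesis using D_value[OF l] I[OF l] by simp
  qed
  moreover have "\<I> differentiable (at l) \<and> 2 * l * deriv \<I> l = ridge_df X (1 / l)" if l: "l > 0" for l
    using I_deriv[OF l] DERIV_imp_deriv[OF I_deriv[OF l]] df_D[OF l]
    by (auto simp: real_differentiable_def mult.commute)
  ultimately show ?thesis using I df unfolding J_def by blast
qed

end
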